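(* Let $A=1_Ae_1+2_Ae_2\in\mathbb{C}_2^{n\times m}$ be a bicomplex matrix. Then the dimension of the idempotent column space of $A$ equals the dimension of the idempotent row space of $A$, i.e. $\rho_{ir}(A)=\rho_{ic}(A)$.
   Context: $\mathbb{C}_1$ denotes the complex numbers (imaginary unit $i_1$). $\mathbb{C}_2=\{z_1+i_2z_2: z_1,z_2\in\mathbb{C}_1\}$ is the commutative ring of bicomplex numbers, where $i_1i_2=i_2i_1$, $i_1^2=i_2^2=-1$. Put $e_1=\frac{1+i_1i_2}{2}$, $e_2=\frac{1-i_1i_2}{2}$; every $\xi\in\mathbb{C}_2$ is uniquely $\xi=1_\xi e_1+2_\xi e_2$ with $1_\xi,2_\xi\in\mathbb{C}_1$, and operations are component-wise in this representation. For $A=[\xi_{ij}]\in\mathbb{C}_2^{n\times m}$ put $1_A=[1_{\xi_{ij}}]$, $2_A=[2_{\xi_{ij}}]\in\mathbb{C}_1^{n\times m}$, so $A=1_Ae_1+2_Ae_2$ uniquely. For $V\subseteq\mathbb{C}_1^k$ and $i\in\{1,2\}$, $Ve_i=\{(x_1e_i,\ldots,x_ke_i):(x_1,\ldots,x_k)\in V\}\subseteq\mathbb{C}_2^k$. The idempotent row space of $A$ is (row space of $1_A$)$e_1$ + (row space of $2_A$)$e_2\subseteq\mathbb{C}_2^m$, and the idempotent column space of $A$ is (column space of $1_A$)$e_1$ + (column space of $2_A$)$e_2\subseteq\mathbb{C}_2^n$, where row and column spaces of complex matrices are the usual ones over $\mathbb{C}_1$. These are $\mathbb{C}_1$-subspaces;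 their dimensions over $\mathbb{C}_1$ are $\rho_{ir}(A)$ and $\rho_{ic}(A)$, respectively. *)

theory Defs
  imports "HOL-Analysis.Analysis"
begin

text \<open>\<open>Bicomplex z w\<close> stands for $z + i_2 w$ with \<open>z\<close>, \<open>w\<close> complex.\<close>

datatype bicomplex = Bicomplex (bc_fst: complex) (bc_snd: complex)

instantiation bicomplex :: comm_ring_1
begin

definition "0 = Bicomplex 0 0"
definition "1 = Bicomplex 1 0"
definition "x + y = Bicomplex (bc_fst x + bc_fst y) (bc_snd x + bc_snd y)"
definition "x - y = Bicomplex (bc_fst x - bc_fst y) (bc_snd x - bc_snd y)"
definition "- x = Bicomplex (- bc_fst x) (- bc_snd x)"
definition "x * y = Bicomplex (bc_fst x * bc_fst y - bc_snd x * bc_snd y)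
                              (bc_fst x * bc_snd y + bc_snd x * bc_fst y)"

instance
  by standard
    (auto simp: zero_bicomplex_def one_bicomplex_def plus_bicomplex_def minus_bicomplex_def
      uminus_bicomplex_def times_bicomplex_def algebra_simps)

end

definition bc_of_complex :: "complex \<Rightarrow> bicomplex" where
  "bc_of_complex z = Bicomplex z 0"

definition bc_i1 :: bicomplex where "bc_i1 = bc_of_complex \<i>"
definition bc_i2 :: bicomplex where "bc_i2 = Bicomplex 0 1"

definition bc_e1 :: bicomplex where "bc_e1 = bc_of_complex (1/2) * (1 + bc_i1 * bc_i2)"
definition bc_e2 :: bicomplex where "bc_e2 = bc_of_complex (1/2) * (1 - bc_i1 * bc_i2)"

lemmas bc_defs = zero_bicomplex_def one_bicomplex_def plus_bicomplex_def minus_bicomplex_def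
  uminus_bicomplex_def times_bicomplex_def bc_of_complex_def bc_i1_def bc_i2_def
  bc_e1_def bc_e2_def

lemma bicomplex_eq: "x = bc_of_complex (bc_fst x) + bc_i2 * bc_of_complex (bc_snd x)"
  by (simp add: bc_defs)

lemma bc_i1_squared: "bc_i1 * bc_i1 = -1" and bc_i2_squared: "bc_i2 * bc_i2 = -1"
  by (simp_all add: bc_defs)

text \<open>The idempotent components; \<open>bc_idem_unique\<close> below characterises them by
  $\xi = 1_\xi e_1 + 2_\xi e_2$.\<close>

definition bc_idem1 :: "bicomplex \<Rightarrow> complex" where
  "bc_idem1 x = bc_fst x - \<i> * bc_snd x"
definition bc_idem2 :: "bicomplex \<Rightarrow> complex" where
  "bc_idem2 x = bc_fst x + \<i> * bc_snd x"

lemma bc_idem_decomp: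
  "x = bc_of_complex (bc_idem1 x) * bc_e1 + bc_of_complex (bc_idem2 x) * bc_e2"
  by (cases x) (simp add: bc_defs bc_idem1_def bc_idem2_def field_simps)

lemma bc_idem_unique:
  "x = bc_of_complex a * bc_e1 + bc_of_complex b * bc_e2 \<longleftrightarrow> a = bc_idem1 x \<and> b = bc_idem2 x"
  (is "?L \<longleftrightarrow> ?R")
proof
  assume x: ?L
  show ?R unfolding x by (simp add: bc_defs bc_idem1_def bc_idem2_def field_simps)
next
  assume ?R
  then show ?L using bc_idem_decomp[of x] by simp
qed

definition bc_mat1 :: "bicomplex^'m^'n \<Rightarrow> complex^'m^'n" where
  "bc_mat1 A = (\<chi> i j. bc_idem1 (A $ i $ j))"
definition bc_mat2 :: "bicomplex^'m^'n \<Rightarrow> complex^'m^'n" where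
  "bc_mat2 A = (\<chi> i j. bc_idem2 (A $ i $ j))"

definition bc_scale :: "complex \<Rightarrow> bicomplex^'k \<Rightarrow> bicomplex^'k" where
  "bc_scale c v = (\<chi> i. bc_of_complex c * v $ i)"

interpretation bcvec: vector_space "bc_scale :: complex \<Rightarrow> bicomplex^'k \<Rightarrow> bicomplex^'k"
  by unfold_locales (simp_all add: bc_scale_def vec_eq_iff bc_defs algebra_simps)

text \<open>\<open>bc_set_times V e\<close> is $V e = \{(x_1 e, \ldots, x_k e) : x \in V\}$.\<close>

definition bc_set_times :: "(complex^'k) set \<Rightarrow> bicomplex \<Rightarrow> (bicomplex^'k) set" where
  "bc_set_times V e = (\<lambda>x. \<chi> i. bc_of_complex (x $ i) * e) ` V"

definition complex_row_space :: "complex^'m^'n \<Rightarrow> (complex^'m) set" where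
  "complex_row_space M = vec.span (rows M)"
definition complex_column_space :: "complex^'m^'n \<Rightarrow> (complex^'n) set" where
  "complex_column_space M = vec.span (columns M)"

definition idem_row_space :: "bicomplex^'m^'n \<Rightarrow> (bicomplex^'m) set" where
  "idem_row_space A =
     {u + v |u v. u \<in> bc_set_times (complex_row_space (bc_mat1 A)) bc_e1 \<and>
                  v \<in> bc_set_times (complex_row_space (bc_mat2 A)) bc_e2}"

definition idem_column_space :: "bicomplex^'m^'n \<Rightarrow> (bicomplex^'n) set" where
  "idem_column_space A =
     {u + v |u v. u \<in> bc_set_times (complex_column_space (bc_mat1 A)) bc_e1 \<and>
                  v \<in> bc_set_times (complex_column_space (bc_mat2 A)) bc_e2}"

definition rho_ir :: "bicomplex^'m^'n \<Rightarrow> nat" where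
  "rho_ir A = bcvec.dim (idem_row_space A)"
definition rho_ic :: "bicomplex^'m^'n \<Rightarrow> nat" where
  "rho_ic A = bcvec.dim (idem_column_space A)"

end

theory Submission
  imports Defs
begin

text \<open>Multiplication by the idempotents embeds the complex row (column) spaces of \<open>1\<^sub>A\<close> and \<open>2\<^sub>A\<close>
  linearly into bicomplex vectors with trivially intersecting images, so the idempotent row
  (column) space has dimension the sum of the two complex row (column) ranks. The theorem thus reduces
  to equality of row and column rank over the complex field, which follows from factoring a matrix
  through a basis of its column space.\<close>

lemma vec_dim_rows_le_dim_columns:
  fixes M :: "'a::field^'m^'n"
  shows "vec.dim (rows M) \<le> vec.dim (columns M)"
proof -
  obtain B where B: "B \<subseteq> columns M" "vec.independent B" "columns M \<subseteq> vec.span B"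
      "card B = vec.dim (columns M)"
    by (rule vec.basis_exists)
  have "finite B"
    using B(2) by (rule vec.finiteI_independent)
  have "\<exists>c. column j M = (\<Sum>b\<in>B. c b *s b)" for j
  proof -
    have "column j M \<in> vec.span B"
      using B(3) by (auto simp: columns_def)
    then show ?thesis
      by (auto simp: vec.span_finite[OF \<open>finite B\<close>])
  qed
  then obtain c where c: "\<And>j. column j M = (\<Sum>b\<in>B. c j b *s b)"
    by metis
  \<comment> \<open>Taking coordinate \<open>i\<close> of every column expansion exchanges the
    roles: the entries \<open>b $ i\<close> become scalars and the coefficients
    \<open>c j b\<close>, collected over \<open>j\<close>, become at most \<open>card B\<close>
    vectors spanning all rows.\<close>
  have "row i M = (\<Sum>b\<in>B. (b $ i) *s (\<chi> j. c j b))" for i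
  proof -
    have "row i M $ j = (\<Sum>b\<in>B. (b $ i) *s (\<chi> j. c j b)) $ j" for j
      using arg_cong[OF c[of j], of "\<lambda>v. v $ i"]
      by (simp add: row_def column_def mult.commute)
    then show ?thesis
      by (simp add: vec_eq_iff)
  qed
  then have "rows M \<subseteq> vec.span ((\<lambda>b. \<chi> j. c j b) ` B)"
    by (auto simp: rows_def intro!: vec.span_sum vec.span_scale intro: vec.span_base)
  then have "vec.dim (rows M) \<le> card ((\<lambda>b. \<chi> j. c j b) ` B)"
    using \<open>finite B\<close> by (intro vec.dim_le_card) auto
  also have "\<dots> \<le> card B"
    using \<open>finite B\<close> by (rule card_image_le)
  finally show ?thesis
    using B(4) by simp
qed

lemma vec_dim_rows_eq_dim_columns:
  fixes M :: "'a::field^'m^'n"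
  shows "vec.dim (rows M) = vec.dim (columns M)"
  using vec_dim_rows_le_dim_columns[of M] vec_dim_rows_le_dim_columns[of "transpose M"]
  by (simp add: rows_transpose columns_transpose)

text \<open>Names the map whose image is \<open>bc_set_times\<close>, so that facts about linear
  maps apply to it.\<close>

definition bc_vec_times :: "bicomplex \<Rightarrow> complex^'k \<Rightarrow> bicomplex^'k" where
  "bc_vec_times e x = (\<chi> i. bc_of_complex (x $ i) * e)"

lemma bc_set_times_eq_image: "bc_set_times V e = bc_vec_times e ` V"
  by (simp add: bc_set_times_def bc_vec_times_def)

lemma linear_bc_vec_times: "Vector_Spaces.linear (*s) bc_scale (bc_vec_times e)"
  by unfold_locales
    (simp_all add: bc_vec_times_def bc_scale_def vec_eq_iff bc_defs algebra_simps)

text \<open>Uniqueness of the idempotent components, applied to each coordinate. Setting suitable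
  arguments to 0 gives injectivity of both embeddings and the trivial intersection of their
  images.\<close>

lemma bc_vec_times_idem_sum_eq_iff:
  "bc_vec_times bc_e1 x + bc_vec_times bc_e2 y = bc_vec_times bc_e1 x' + bc_vec_times bc_e2 y'
    \<longleftrightarrow> x = x' \<and> y = y'"
proof -
  have "bc_of_complex a * bc_e1 + bc_of_complex b * bc_e2
      = bc_of_complex a' * bc_e1 + bc_of_complex b' * bc_e2 \<longleftrightarrow> a = a' \<and> b = b'" for a b a' b'
    by (metis bc_idem_unique)
  then show ?thesis
    by (auto simp: bc_vec_times_def vec_eq_iff)
qed

lemma bc_vec_times_zero [simp]: "bc_vec_times e 0 = 0"
  by (simp add: bc_vec_times_def vec_eq_iff bc_defs)

lemma inj_bc_vec_times_e1: "inj (bc_vec_times bc_e1)"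
  using bc_vec_times_idem_sum_eq_iff[of _ 0 _ 0] by (auto intro: injI)

lemma inj_bc_vec_times_e2: "inj (bc_vec_times bc_e2)"
  using bc_vec_times_idem_sum_eq_iff[of 0 _ 0] by (auto intro: injI)

lemma bc_vec_idem_decomp:
  "v = bc_vec_times bc_e1 (\<chi> i. bc_idem1 (v $ i)) + bc_vec_times bc_e2 (\<chi> i. bc_idem2 (v $ i))"
  using bc_idem_decomp by (simp add: bc_vec_times_def vec_eq_iff)

text \<open>Supplies the basis that makes \<open>bc_scale\<close> an instance of the
  finite-dimensional locale. The images of the standard basis under both embeddings span by the
  idempotent decomposition, and a maximal independent subset of them is a basis.\<close>

lemma ex_finite_basis_bcvec:
  "\<exists>B :: (bicomplex^'k) set. finite B \<and> bcvec.independent B \<and> bcvec.span B = UNIV"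
proof -
  let ?F = "bc_vec_times bc_e1 ` cart_basis \<union> bc_vec_times bc_e2 ` cart_basis
    :: (bicomplex^'k) set"
  have range: "range (bc_vec_times e) = bcvec.span (bc_vec_times e ` (cart_basis :: (complex^'k) set))"
    for e
  proof -
    interpret Vector_Spaces.linear "(*s)" bc_scale "bc_vec_times e :: complex^'k \<Rightarrow> _"
      by (rule linear_bc_vec_times)
    show ?thesis
      by (simp add: span_image span_cart_basis)
  qed
  have "v \<in> bcvec.span ?F" for v
  proof -
    have "bc_vec_times bc_e1 x \<in> bcvec.span ?F" "bc_vec_times bc_e2 x \<in> bcvec.span ?F" for x
      using range bcvec.span_mono[of _ ?F] by blast+
    then show ?thesis
      by (subst bc_vec_idem_decomp) (intro bcvec.span_add)
  qed
  moreover obtain B where "B \<subseteq> ?F" "bcvec.independent B" "?F \<subseteq> bcvec.span B"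
    by (rule bcvec.maximal_independent_subset)
  moreover have "finite ?F"
    by (simp add: finite_cart_basis)
  ultimately show ?thesis
    by (metis UNIV_eq_I bcvec.span_mono bcvec.span_span finite_subset subsetD)
qed

text \<open>The dimension formula for a sum of two subspaces: the intersection contributes 0, and
  each summand is an injective linear image.\<close>

lemma dim_idem_sum:
  assumes "vec.subspace V" "vec.subspace W"
  shows "bcvec.dim {u + v |u v. u \<in> bc_set_times V bc_e1 \<and> v \<in> bc_set_times W bc_e2}
    = vec.dim V + vec.dim (W :: (complex^'k) set)"
proof -
  obtain B :: "(bicomplex^'k) set"
    where B: "finite B" "bcvec.independent B" "bcvec.span B = UNIV"
    using ex_finite_basis_bcvec by blast
  interpret fd: finite_dimensional_vector_space "bc_scale :: _ \<Rightarrow> bicomplex^'k \<Rightarrow> _" B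
    by unfold_locales (fact B)+
  interpret p: finite_dimensional_vector_space_pair_1
    "(*s)" "cart_basis :: (complex^'k) set" "bc_scale :: _ \<Rightarrow> bicomplex^'k \<Rightarrow> _"
    by unfold_locales
  let ?V = "bc_set_times V bc_e1" and ?W = "bc_set_times W bc_e2"
  have "bcvec.subspace ?V" "bcvec.subspace ?W"
    unfolding bc_set_times_eq_image
    by (intro p.linear_subspace_image linear_bc_vec_times assms)+
  then have "bcvec.dim {u + v |u v. u \<in> ?V \<and> v \<in> ?W} + bcvec.dim (?V \<inter> ?W)
      = bcvec.dim ?V + bcvec.dim ?W"
    by (rule fd.dim_sums_Int)
  moreover have "?V \<inter> ?W \<subseteq> {0}"
  proof
    fix u
    assume "u \<in> ?V \<inter> ?W"
    then obtain x y where "u = bc_vec_times bc_e1 x" "u = bc_vec_times bc_e2 y"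
      unfolding bc_set_times_eq_image by blast
    then show "u \<in> {0}"
      \<comment> \<open>Padding with zeros turns the two forms of \<open>u\<close> into two
        decompositions of one vector, which forces \<open>x = 0\<close>.\<close>
      using bc_vec_times_idem_sum_eq_iff[of x 0 0 y] by simp
  qed
  then have "bcvec.dim (?V \<inter> ?W) = 0"
    by (simp add: fd.dim_eq_0)
  moreover have "bcvec.dim ?V = vec.dim V" "bcvec.dim ?W = vec.dim W"
    unfolding bc_set_times_eq_image
    using inj_bc_vec_times_e1 inj_bc_vec_times_e2
    by (auto intro!: p.dim_image_eq linear_bc_vec_times intro: inj_on_subset)
  ultimately show ?thesis
    by simp
qed

theorem proposition2p50:
  fixes A :: "bicomplex^'m^'n"
  shows "rho_ir A = rho_ic A"
  \<comment> \<open>Spans are subspaces with the dimension of their generating sets, so both sides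
    become sums of dimensions of \<open>rows\<close> or \<open>columns\<close>.\<close>
  by (simp add: rho_ir_def rho_ic_def idem_row_space_def idem_column_space_def
    complex_row_space_def complex_column_space_def dim_idem_sum vec_dim_rows_eq_dim_columns)

end
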